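(* Let $h$ be a regularizer function on $\mathcal{C}$ that is $K$-strongly convex with respect to $\|\cdot\|$ (where $K>0$), let $M>0$, and let $(u_n)_{n\geq1}$ be a sequence of payoff vectors in $V^*$ with $\|u_n\|_*\leq M$ for all $n$. Then the sequence of play given by $x_1=Q_h(0)$ and $$x_{n+1}=Q_h\left(\sqrt{\frac{K(h_{\max}-h_{\min})}{M^2n}}\sum_{k=1}^nu_k\right),\quad n\geq1,$$ guarantees, for every $n\geq1$, the regret bound $$\max_{x\in\mathcal{C}}\left(\sum_{k=1}^n\langle u_k|x\rangle-\sum_{k=1}^n\langle u_k|x_k\rangle\right)\leq2M\sqrt{\frac{h_{\max}-h_{\min}}{K}}\left(\frac14+\sqrt n\right).$$
   Context: $V=\mathbb{R}^d$ is equipped with an arbitrary norm $\|\cdot\|$, $V^*$ is its dual with dual norm $\|y\|_*=\sup_{\|x\|\leq1}|\langle y|x\rangle|$, and $\langle y|x\rangle$ denotes the canonical pairing. $\mathcal{C}\subset V$ is a nonempty compact convex set. A convex function $h:V\to\mathbb{R}\cup\{+\infty\}$ is a regularizer function on $\mathcal{C}$ if its effective domain $\{x:h(x)<\infty\}$ equals $\mathcal{C}$ and $h|_{\mathcal{C}}$ is strictly convex and continuous. It is $K$-strongly convex w.r.t. $\|\cdot\|$ if $h(\lambda w_1+(1-\lambda)w_2)\leq\lambda h(w_1)+(1-\lambda)h(w_2)-\frac12K\lambda(1-\lambda)\|w_2-w_1\|^2$ for all $w_1,w_2\in V$ and $\lambda\in[0,1]$. The choice map $Q_h:V^*\to\mathcal{C}$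 is $Q_h(y)=\arg\max_{x\in\mathcal{C}}\{\langle y|x\rangle-h(x)\}$ (the maximizer exists and is unique). $h_{\max}$ and $h_{\min}$ denote the maximum and minimum of $h$ over $\mathcal{C}$. *)

theory Defs
  imports "HOL-Analysis.Analysis"
begin

text \<open>
  The space is \<open>real ^ 'd\<close> with an arbitrary norm \<open>N\<close>, passed as an explicit argument because it
  need not be the Euclidean one. All norms on a finite-dimensional space induce the same topology
  and make every linear functional continuous, so compactness and continuity are the library's,
  and the dual space is \<open>(real ^ 'd) \<Rightarrow>\<^sub>L real\<close>, with \<open>blinfun_apply\<close> as the canonical pairing.
  The library norm on this dual is not used.
\<close>

definition is_norm :: "('a::real_vector \<Rightarrow> real) \<Rightarrow> bool" where
  "is_norm N \<longleftrightarrow>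
     (\<forall>x. 0 \<le> N x) \<and> (\<forall>x. N x = 0 \<longleftrightarrow> x = 0) \<and>
     (\<forall>a x. N (a *\<^sub>R x) = \<bar>a\<bar> * N x) \<and> (\<forall>x y. N (x + y) \<le> N x + N y)"

text \<open>The supremum is over a nonempty set, bounded above by finite dimensionality.\<close>

definition dual_norm :: "(real ^ 'd \<Rightarrow> real) \<Rightarrow> ((real ^ 'd) \<Rightarrow>\<^sub>L real) \<Rightarrow> real" where
  "dual_norm N y = (SUP x\<in>{x. N x \<le> 1}. \<bar>blinfun_apply y x\<bar>)"

definition max_over :: "('a \<Rightarrow> 'b::order) \<Rightarrow> 'a set \<Rightarrow> 'b" where
  "max_over f S = (GREATEST v. v \<in> f ` S)"

definition min_over :: "('a \<Rightarrow> 'b::order) \<Rightarrow> 'a set \<Rightarrow> 'b" where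
  "min_over f S = (LEAST v. v \<in> f ` S)"

lemma max_over_attained:
  fixes f :: "'a::topological_space \<Rightarrow> 'b::linorder_topology"
  assumes "compact S" "S \<noteq> {}" "continuous_on S f"
  shows "max_over f S \<in> f ` S" and "x \<in> S \<Longrightarrow> f x \<le> max_over f S"
proof -
  obtain z where z: "z \<in> S" "\<forall>w\<in>S. f w \<le> f z"
    using continuous_attains_sup[OF assms] by blast
  then have "max_over f S = f z"
    unfolding max_over_def by (intro Greatest_equality) auto
  with z show "max_over f S \<in> f ` S" and "x \<in> S \<Longrightarrow> f x \<le> max_over f S"
    by auto
qed

lemma min_over_attained:
  fixes f :: "'a::topological_space \<Rightarrow> 'b::linorder_topology"
  assumes "compact S" "S \<noteq> {}" "continuous_on S f"
  shows "min_over f S \<in> f ` S" and "x \<in> S \<Longrightarrow> min_over f S \<le> f x"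
proof -
  obtain z where z: "z \<in> S" "\<forall>w\<in>S. f z \<le> f w"
    using continuous_attains_inf[OF assms] by blast
  then have "min_over f S = f z"
    unfolding min_over_def by (intro Least_equality) auto
  with z show "min_over f S \<in> f ` S" and "x \<in> S \<Longrightarrow> min_over f S \<le> f x"
    by auto
qed

text \<open>
  Functions with values in the reals and \<open>\<infinity>\<close> are \<open>ereal\<close>-valued functions avoiding \<open>-\<infinity>\<close>. In the
  inequalities below \<open>0 * \<infinity> = 0\<close>, so the non-strict ones hold trivially for \<open>t = 0\<close> and \<open>t = 1\<close>.
\<close>

definition ext_convex :: "('a::real_vector \<Rightarrow> ereal) \<Rightarrow> bool" where
  "ext_convex h \<longleftrightarrow>
     (\<forall>w1 w2. \<forall>t\<in>{0..1}.
        h (t *\<^sub>R w1 + (1 - t) *\<^sub>R w2) \<le> ereal t * h w1 + ereal (1 - t) * h w2)"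

definition strictly_convex_on :: "'a::real_vector set \<Rightarrow> ('a \<Rightarrow> ereal) \<Rightarrow> bool" where
  "strictly_convex_on C h \<longleftrightarrow>
     (\<forall>w1\<in>C. \<forall>w2\<in>C. \<forall>t\<in>{0<..<1}. w1 \<noteq> w2 \<longrightarrow>
        h (t *\<^sub>R w1 + (1 - t) *\<^sub>R w2) < ereal t * h w1 + ereal (1 - t) * h w2)"

definition regularizer :: "(real ^ 'd) set \<Rightarrow> (real ^ 'd \<Rightarrow> ereal) \<Rightarrow> bool" where
  "regularizer C h \<longleftrightarrow>
     (\<forall>x. h x \<noteq> -\<infinity>) \<and> ext_convex h \<and> {x. h x < \<infinity>} = C \<and>
     strictly_convex_on C h \<and> continuous_on C h"

definition strongly_convex ::
    "('a::real_vector \<Rightarrow> real) \<Rightarrow> real \<Rightarrow> ('a \<Rightarrow> ereal) \<Rightarrow> bool" where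
  "strongly_convex N K h \<longleftrightarrow>
     (\<forall>w1 w2. \<forall>t\<in>{0..1}.
        h (t *\<^sub>R w1 + (1 - t) *\<^sub>R w2)
          \<le> ereal t * h w1 + ereal (1 - t) * h w2
             - ereal (1 / 2 * K * t * (1 - t) * (N (w2 - w1))\<^sup>2))"

definition choice_map ::
    "(real ^ 'd) set \<Rightarrow> (real ^ 'd \<Rightarrow> ereal) \<Rightarrow> ((real ^ 'd) \<Rightarrow>\<^sub>L real) \<Rightarrow> real ^ 'd" where
  "choice_map C h y = arg_max_on (\<lambda>x. ereal (blinfun_apply y x) - h x) C"

lemma choice_map_unique:
  fixes C :: "(real ^ 'd) set"
  assumes "C \<noteq> {}" "compact C" "convex C" "regularizer C h"
  shows "is_arg_max (\<lambda>x. ereal (blinfun_apply y x) - h x) (\<lambda>x. x \<in> C) z \<longleftrightarrow> z = choice_map C h y"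
proof -
  define g where "g x = real_of_ereal (h x)" for x
  define f where "f x = blinfun_apply y x - g x" for x
  let ?F = "\<lambda>x. ereal (blinfun_apply y x) - h x"
  from assms(4) have fin: "h x = ereal (g x)" if "x \<in> C" for x
    using that unfolding regularizer_def g_def by (cases "h x") auto
  have Ff: "?F x = ereal (f x)" if "x \<in> C" for x
    using fin[OF that] by (simp add: f_def)
  have strict: "f z < f ((1/2) *\<^sub>R z + (1/2) *\<^sub>R w) \<or> f w < f ((1/2) *\<^sub>R z + (1/2) *\<^sub>R w)"
    and mid: "(1/2) *\<^sub>R z + (1/2) *\<^sub>R w \<in> C"
    if "z \<in> C" "w \<in> C" "z \<noteq> w" for z w
  proof -
    let ?m = "(1/2) *\<^sub>R z + (1/2) *\<^sub>R w"
    show m: "?m \<in> C"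
      using assms(3) that unfolding convex_def by simp
    have "strictly_convex_on C h"
      using assms(4) by (simp add: regularizer_def)
    then have "h (t *\<^sub>R z + (1 - t) *\<^sub>R w) < ereal t * h z + ereal (1 - t) * h w"
      if "t \<in> {0<..<1}" for t
      using that \<open>z \<in> C\<close> \<open>w \<in> C\<close> \<open>z \<noteq> w\<close> unfolding strictly_convex_on_def by blast
    from this[of "1/2"] have "h ?m < ereal (1/2) * h z + ereal (1/2) * h w"
      by simp
    then have "g ?m < (g z + g w) / 2"
      using fin[OF that(1)] fin[OF that(2)] fin[OF m] by (simp add: field_simps)
    moreover have "blinfun_apply y ?m = (blinfun_apply y z + blinfun_apply y w) / 2"
      by (simp add: blinfun.add_right blinfun.scaleR_right field_simps)
    ultimately show "f z < f ?m \<or> f w < f ?m"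
      unfolding f_def by argo
  qed
  have uniq: "z = w"
    if "is_arg_max ?F (\<lambda>x. x \<in> C) z" "is_arg_max ?F (\<lambda>x. x \<in> C) w" for z w
  proof (rule ccontr)
    assume "z \<noteq> w"
    with that strict[of z w] mid[of z w] show False
      unfolding is_arg_max_def using Ff by (metis less_ereal.simps(1))
  qed
  have "continuous_on C h"
    using assms(4) by (simp add: regularizer_def)
  moreover have "h ` C \<subseteq> UNIV - {\<infinity>, -\<infinity>}"
    using fin by auto
  ultimately have "continuous_on C (real_of_ereal \<circ> h)"
    by (meson continuous_on_compose continuous_on_real continuous_on_subset)
  then have "continuous_on C g"
    by (simp add: g_def o_def)
  then have "continuous_on C f"
    unfolding f_def by (intro continuous_intros)
  then obtain z0 where "z0 \<in> C" "\<forall>w\<in>C. f w \<le> f z0"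
    using continuous_attains_sup[OF assms(2,1)] by blast
  then have "is_arg_max ?F (\<lambda>x. x \<in> C) z0"
    unfolding is_arg_max_def using Ff by (metis ereal_less_eq(3) not_le)
  then have "is_arg_max ?F (\<lambda>x. x \<in> C) (choice_map C h y)"
    unfolding choice_map_def arg_max_on_def arg_max_def by (rule someI)
  with uniq show ?thesis by blast
qed

end

theory Submission
  imports Defs
begin

text \<open>
  The potential \<open>\<Phi>\<^sub>n = max\<^sub>z (\<langle>U\<^sub>n|z\<rangle> - (h z - h_min) / \<eta>\<^sub>n)\<close>, where \<open>U\<^sub>n = u\<^sub>1 + \<dots> + u\<^sub>n\<close>, starts at
  \<open>0\<close> and does not increase when \<open>\<eta>\<close> decreases. By strong convexity the maximand falls off
  quadratically away from its maximizer, so adding \<open>u\<^sub>n\<^sub>+\<^sub>1\<close> raises the potential by at most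
  \<open>\<langle>u\<^sub>n\<^sub>+\<^sub>1|x\<^sub>n\<^sub>+\<^sub>1\<rangle> + \<eta>\<^sub>n M\<^sup>2 / (2 K)\<close>. Summing up bounds the regret by
  \<open>(h_max - h_min) / \<eta>\<^sub>n + M\<^sup>2 / (2 K) * (\<eta>\<^sub>0 + \<dots> + \<eta>\<^sub>n\<^sub>-\<^sub>1)\<close>. As \<open>x\<^sub>1\<close> is computed from the zero
  vector, \<open>\<eta>\<^sub>0\<close> is free; it is taken equal to \<open>\<eta>\<^sub>1\<close>.
\<close>

section \<open>The norm \<open>N\<close> and its dual\<close>

text \<open>A convex function on a finite-dimensional space is continuous, so \<open>N\<close> has a
  minimum on the Euclidean unit sphere. Definiteness makes it positive and homogeneity carries the
  bound to all vectors.\<close>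

lemma is_norm_lower_bound:
  fixes N :: "'a::euclidean_space \<Rightarrow> real"
  assumes "is_norm N"
  obtains c where "c > 0" "\<And>x. c * norm x \<le> N x"
proof -
  note N = assms[unfolded is_norm_def]
  have "convex_on UNIV N"
  proof (rule convex_onI)
    fix t :: real and x y :: 'a
    assume "0 < t" "t < 1"
    have "N ((1 - t) *\<^sub>R x + t *\<^sub>R y) \<le> N ((1 - t) *\<^sub>R x) + N (t *\<^sub>R y)"
      using N by blast
    also have "\<dots> = \<bar>1 - t\<bar> * N x + \<bar>t\<bar> * N y"
      using N by metis
    finally show "N ((1 - t) *\<^sub>R x + t *\<^sub>R y) \<le> (1 - t) * N x + t * N y"
      using \<open>0 < t\<close> \<open>t < 1\<close> by simp
  qed simp
  then have "continuous_on UNIV N"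
    by (intro convex_on_continuous) auto
  then have "continuous_on (sphere 0 1) N"
    using continuous_on_subset by blast
  moreover have "sphere (0::'a) 1 \<noteq> {}"
    by simp
  ultimately obtain z where z: "z \<in> sphere 0 1" "\<forall>w\<in>sphere 0 1. N z \<le> N w"
    using continuous_attains_inf[OF compact_sphere] by blast
  from z(1) have "z \<noteq> 0"
    by auto
  then have "N z > 0"
    using N by (metis less_eq_real_def)
  moreover have "N z * norm x \<le> N x" for x
  proof (cases "x = 0")
    case True
    then show ?thesis
      using N by simp
  next
    case False
    then have "N z \<le> N (inverse (norm x) *\<^sub>R x)"
      using z(2) by simp
    also have "\<dots> = inverse (norm x) * N x"
      using N by simp
    finally show ?thesis
      using False by (simp add: field_simps)
  qed
  ultimately show thesis
    using that by blast
qed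

lemma dual_norm_bound:
  assumes "is_norm N"
  shows "\<bar>blinfun_apply y x\<bar> \<le> dual_norm N y * N x"
proof -
  note N = assms[unfolded is_norm_def]
  obtain c where c: "c > 0" "\<And>x. c * norm x \<le> N x"
    using is_norm_lower_bound[OF assms] by blast
  \<comment> \<open>The \<open>SUP\<close> in \<open>dual_norm\<close> bounds its elements only if
    the set is bounded above. The unit ball of \<open>N\<close> lies in a Euclidean ball of radius
    \<open>1 / c\<close>, on which \<open>y\<close> is bounded.\<close>
  have bdd: "bdd_above ((\<lambda>x. \<bar>blinfun_apply y x\<bar>) ` {x. N x \<le> 1})"
  proof (rule bdd_aboveI2)
    fix x assume "x \<in> {x. N x \<le> 1}"
    then have "c * norm x \<le> 1"
      using c(2)[of x] by simp
    then have "norm x \<le> 1 / c"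
      using c(1) by (simp add: field_simps)
    moreover have "\<bar>blinfun_apply y x\<bar> \<le> norm y * norm x"
      using norm_blinfun[of y x] by simp
    ultimately show "\<bar>blinfun_apply y x\<bar> \<le> norm y * (1 / c)"
      by (meson mult_left_mono norm_ge_zero order_trans)
  qed
  show ?thesis
  proof (cases "x = 0")
    case True
    moreover from this have "N x = 0"
      using N by blast
    ultimately show ?thesis
      by simp
  next
    case False
    then have pos: "N x > 0"
      using N by (metis less_eq_real_def)
    have "N (inverse (N x) *\<^sub>R x) = \<bar>inverse (N x)\<bar> * N x"
      using N by blast
    then have "N (inverse (N x) *\<^sub>R x) \<le> 1"
      using pos by simp
    then have "\<bar>blinfun_apply y (inverse (N x) *\<^sub>R x)\<bar> \<le> dual_norm N y"
      unfolding dual_norm_def by (intro cSUP_upper bdd) simp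
    then show ?thesis
      using pos by (simp add: blinfun.scaleR_right abs_mult field_simps)
  qed
qed

section \<open>The choice map and strong convexity\<close>

lemma regularizer_finite:
  assumes "regularizer C h" "x \<in> C"
  shows "h x = ereal (real_of_ereal (h x))"
  using assms unfolding regularizer_def by (cases "h x") auto

lemma choice_map_maximizes:
  fixes C :: "(real ^ 'd) set"
  assumes "C \<noteq> {}" "compact C" "convex C" "regularizer C h"
  shows "choice_map C h y \<in> C"
    and "z \<in> C \<Longrightarrow> blinfun_apply y z - real_of_ereal (h z)
            \<le> blinfun_apply y (choice_map C h y) - real_of_ereal (h (choice_map C h y))"
proof -
  have *: "is_arg_max (\<lambda>x. ereal (blinfun_apply y x) - h x) (\<lambda>x. x \<in> C) (choice_map C h y)"
    using choice_map_unique[OF assms] by blast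
  then show Q: "choice_map C h y \<in> C"
    by (simp add: is_arg_max_def)
  assume z: "z \<in> C"
  with * have "ereal (blinfun_apply y z) - h z
      \<le> ereal (blinfun_apply y (choice_map C h y)) - h (choice_map C h y)"
    unfolding is_arg_max_def by (meson not_le)
  then show "blinfun_apply y z - real_of_ereal (h z)
      \<le> blinfun_apply y (choice_map C h y) - real_of_ereal (h (choice_map C h y))"
    using regularizer_finite[OF assms(4) z] regularizer_finite[OF assms(4) Q]
    by (metis ereal_less_eq(3) ereal_minus(1))
qed

text \<open>Move from \<open>q\<close> a fraction \<open>t\<close> of the way to \<open>z\<close>.
  The objective there is at most its maximum, while strong convexity bounds it below by the
  interpolated value plus a quadratic gain. Cancelling and dividing by \<open>t\<close> leaves the
  claim with an extra factor \<open>1 - t\<close> on the gain.\<close>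

lemma choice_map_quadratic_growth:
  fixes C :: "(real ^ 'd) set" and y :: "(real ^ 'd) \<Rightarrow>\<^sub>L real"
  assumes "C \<noteq> {}" "compact C" "convex C" "regularizer C h" "strongly_convex N K h" "z \<in> C"
  defines "q \<equiv> choice_map C h y"
  shows "blinfun_apply y z - real_of_ereal (h z) + K / 2 * (N (q - z))\<^sup>2
           \<le> blinfun_apply y q - real_of_ereal (h q)"
proof -
  define g where "g x = real_of_ereal (h x)" for x
  note fin = regularizer_finite[OF assms(4), folded g_def]
  have q: "q \<in> C"
    unfolding q_def by (rule choice_map_maximizes[OF assms(1-4)])
  let ?L = "blinfun_apply y z - g z" and ?R = "blinfun_apply y q - g q"
  have "?L + K / 2 * (1 - t) * (N (q - z))\<^sup>2 \<le> ?R" if t: "0 < t" "t < 1" for t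
  proof -
    let ?m = "t *\<^sub>R z + (1 - t) *\<^sub>R q"
    have m: "?m \<in> C"
      using assms(3,6) q t unfolding convex_def by simp
    have "h ?m \<le> ereal t * h z + ereal (1 - t) * h q
             - ereal (1 / 2 * K * t * (1 - t) * (N (q - z))\<^sup>2)"
      using assms(5) t unfolding strongly_convex_def by simp
    then have "g ?m \<le> t * g z + (1 - t) * g q - 1 / 2 * K * t * (1 - t) * (N (q - z))\<^sup>2"
      unfolding fin[OF m] fin[OF q] fin[OF assms(6)] by simp
    moreover have "blinfun_apply y ?m - g ?m \<le> ?R"
      unfolding g_def q_def by (rule choice_map_maximizes(2)[OF assms(1-4)]) (use m q_def in simp)
    moreover have "blinfun_apply y ?m = t * blinfun_apply y z + (1 - t) * blinfun_apply y q"
      by (simp add: blinfun.add_right blinfun.scaleR_right)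
    ultimately have "t * (?L + K / 2 * (1 - t) * (N (q - z))\<^sup>2) \<le> t * ?R"
      by (simp add: algebra_simps)
    with t show ?thesis
      by simp
  qed
  \<comment> \<open>Because of the division by \<open>t\<close>, the full constant
    \<open>K / 2\<close> is reached only in the limit from the right at 0.\<close>
  then have ev: "\<forall>\<^sub>F t in at_right 0. ?L + K / 2 * (1 - t) * (N (q - z))\<^sup>2 \<le> ?R"
    by (auto simp: eventually_at_right_field intro: exI[of _ 1])
  have "((\<lambda>t. ?L + K / 2 * (1 - t) * (N (q - z))\<^sup>2)
      \<longlongrightarrow> ?L + K / 2 * (1 - 0) * (N (q - z))\<^sup>2) (at_right 0)"
    by (intro tendsto_intros)
  from tendsto_upperbound[OF this ev] show ?thesis
    by (simp add: g_def)
qed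

text \<open>Controls one round: moving from \<open>q\<close> to \<open>z\<close> gains at most
  \<open>\<eta> * M * N (q - z)\<close> from the new payoff \<open>v\<close>, but costs
  \<open>K / 2\<close> times the squared distance. Completing the square leaves an error independent
  of the distance.\<close>

lemma choice_map_step:
  fixes C :: "(real ^ 'd) set" and y :: "(real ^ 'd) \<Rightarrow>\<^sub>L real"
  assumes "is_norm N" "C \<noteq> {}" "compact C" "convex C" "regularizer C h"
    and "K > 0" "strongly_convex N K h" "z \<in> C" "dual_norm N v \<le> M" "\<eta> \<ge> 0"
  defines "q \<equiv> choice_map C h y"
  shows "blinfun_apply y z - real_of_ereal (h z) + \<eta> * blinfun_apply v z
    \<le> blinfun_apply y q - real_of_ereal (h q) + \<eta> * blinfun_apply v q + \<eta>\<^sup>2 * M\<^sup>2 / (2 * K)"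
proof -
  let ?D = "N (q - z)"
  have "?D \<ge> 0"
    using assms(1) by (simp add: is_norm_def)
  have "blinfun_apply v z - blinfun_apply v q \<le> \<bar>blinfun_apply v (q - z)\<bar>"
    by (simp add: blinfun.diff_right)
  also have "\<dots> \<le> M * ?D"
    using dual_norm_bound[OF assms(1)] mult_right_mono[OF assms(9) \<open>?D \<ge> 0\<close>] order_trans by blast
  finally have "\<eta> * (blinfun_apply v z - blinfun_apply v q) \<le> \<eta> * (M * ?D)"
    using assms(10) by (rule mult_left_mono)
  moreover have "\<eta> * (M * ?D) \<le> K / 2 * ?D\<^sup>2 + \<eta>\<^sup>2 * M\<^sup>2 / (2 * K)"
  proof -
    have "0 \<le> (K * ?D - \<eta> * M)\<^sup>2 / (2 * K)"
      using assms(6) by simp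
    also have "\<dots> = K / 2 * ?D\<^sup>2 + \<eta>\<^sup>2 * M\<^sup>2 / (2 * K) - \<eta> * (M * ?D)"
      using assms(6) by (simp add: field_simps power2_eq_square)
    finally show ?thesis
      by simp
  qed
  ultimately show ?thesis
    using choice_map_quadratic_growth[OF assms(2-5,7,8), of y, folded q_def]
    by (simp add: algebra_simps)
qed

section \<open>Regret for positive nonincreasing rates\<close>

lemma regret_variable_rate:
  fixes C :: "(real ^ 'd) set"
    and u :: "nat \<Rightarrow> (real ^ 'd) \<Rightarrow>\<^sub>L real"
    and \<eta> :: "nat \<Rightarrow> real"
  assumes "is_norm N" "C \<noteq> {}" "compact C" "convex C" "regularizer C h"
    and "K > 0" "strongly_convex N K h"
    and u: "\<And>n. n \<ge> 1 \<Longrightarrow> dual_norm N (u n) \<le> M"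
    and min: "\<And>z. z \<in> C \<Longrightarrow> m \<le> real_of_ereal (h z)"
    and \<eta>: "\<And>n. \<eta> n > 0" "\<And>n. \<eta> (Suc n) \<le> \<eta> n"
    and x: "\<And>n. x (Suc n) = choice_map C h (\<eta> n *\<^sub>R (\<Sum>k=1..n. u k))"
    and "z \<in> C"
  shows "(\<Sum>k=1..n. blinfun_apply (u k) z) - (\<Sum>k=1..n. blinfun_apply (u k) (x k))
    \<le> (real_of_ereal (h z) - m) / \<eta> n + M\<^sup>2 / (2 * K) * (\<Sum>k<n. \<eta> k)"
  using \<open>z \<in> C\<close>
proof (induction n arbitrary: z)
  case 0
  with min[of z] \<eta>(1)[of 0] show ?case
    by simp
next
  case (Suc n)
  define g where "g w = real_of_ereal (h w) - m" for w
  define U where "U w = (\<Sum>k=1..n. blinfun_apply (u k) w)" for w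
  let ?q = "x (Suc n)" and ?v = "blinfun_apply (u (Suc n))" and ?e = "\<eta> n"
  have q: "?q \<in> C"
    unfolding x by (rule choice_map_maximizes[OF assms(2-5)])
  have U: "blinfun_apply (?e *\<^sub>R (\<Sum>k=1..n. u k)) w = ?e * U w" for w
    by (simp add: U_def blinfun.scaleR_left blinfun.sum_left)
  have "?e * U z - g z + ?e * ?v z \<le> ?e * U ?q - g ?q + ?e * ?v ?q + ?e\<^sup>2 * M\<^sup>2 / (2 * K)"
    using choice_map_step[OF assms(1-7) Suc.prems u[of "Suc n"] less_imp_le[OF \<eta>(1)[of n]],
        of "?e *\<^sub>R (\<Sum>k=1..n. u k)", folded x, unfolded U]
    by (simp add: g_def)
  \<comment> \<open>Dividing by the rate moves it from the payoffs to the penalty, so that payoffs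
    of different rounds add up; the error becomes linear in the rate.\<close>
  then have "(?e * (U z + ?v z) - g z) / ?e
      \<le> (?e * (U ?q + ?v ?q) - g ?q + ?e\<^sup>2 * M\<^sup>2 / (2 * K)) / ?e"
    using \<eta>(1)[of n] by (intro divide_right_mono) (auto simp: algebra_simps)
  then have step: "U z + ?v z - g z / ?e \<le> U ?q + ?v ?q - g ?q / ?e + M\<^sup>2 / (2 * K) * ?e"
    using \<eta>(1)[of n] by (simp add: add_divide_distrib diff_divide_distrib power2_eq_square algebra_simps)
  \<comment> \<open>Monotonicity of the rates enters here, together with \<open>g z \<ge> 0\<close>,
    the reason for subtracting \<open>m\<close> in \<open>g\<close>.\<close>
  have "g z / ?e \<le> g z / \<eta> (Suc n)"
    using min[OF Suc.prems] \<eta>(1)[of n] \<eta>(1)[of "Suc n"] \<eta>(2)[of n]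
    by (intro divide_left_mono) (auto simp: g_def)
  \<comment> \<open>The induction hypothesis is applied at the next point played instead of
    \<open>z\<close>, which is why \<open>z\<close> is generalized. This replaces an explicit
    maximum in the potential.\<close>
  moreover have "U ?q - (\<Sum>k=1..n. blinfun_apply (u k) (x k))
      \<le> g ?q / ?e + M\<^sup>2 / (2 * K) * (\<Sum>k<n. \<eta> k)"
    unfolding U_def g_def by (rule Suc.IH[OF q])
  moreover have "(\<Sum>k=1..Suc n. blinfun_apply (u k) z) = U z + ?v z"
    by (simp add: U_def)
  moreover have "(\<Sum>k=1..Suc n. blinfun_apply (u k) (x k))
      = (\<Sum>k=1..n. blinfun_apply (u k) (x k)) + ?v ?q"
    by simp
  moreover have "M\<^sup>2 / (2 * K) * (\<Sum>k<Suc n. \<eta> k)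
      = M\<^sup>2 / (2 * K) * (\<Sum>k<n. \<eta> k) + M\<^sup>2 / (2 * K) * ?e"
    by (simp only: sum.lessThan_Suc distrib_left)
  ultimately show ?case
    unfolding g_def[symmetric] using step by linarith
qed

section \<open>The rate of order \<open>1 / sqrt n\<close>\<close>

text \<open>Telescoping: each new term is at most \<open>2 * ?b - 2 * ?a\<close>, which follows from
  \<open>2 * ?a * ?b \<le> ?a\<^sup>2 + ?b\<^sup>2\<close>.\<close>

lemma sum_inverse_sqrt_le: "(\<Sum>k=1..n. 1 / sqrt (real k)) \<le> 2 * sqrt (real n)"
proof (induction n)
  case (Suc n)
  let ?a = "sqrt (real n)" and ?b = "sqrt (real (Suc n))"
  have b: "?b > 0" "?b\<^sup>2 = ?a\<^sup>2 + 1"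
    by simp_all
  then have "2 * ?a * ?b + 1 \<le> 2 * ?b\<^sup>2"
    using sum_squares_bound[of ?a ?b] by linarith
  then have "1 / ?b \<le> 2 * ?b - 2 * ?a"
    using b(1) by (simp add: field_simps power2_eq_square)
  with Suc show ?case
    by simp
qed simp

text \<open>The midpoint of two distinct points would violate strictness. This settles the
  degenerate case \<open>h_max = h_min\<close>.\<close>

lemma strictly_convex_on_constant:
  assumes "strictly_convex_on C h" "convex C" "\<And>x. x \<in> C \<Longrightarrow> h x = ereal a"
    and "x \<in> C" "y \<in> C"
  shows "x = y"
proof (rule ccontr)
  assume "x \<noteq> y"
  let ?m = "(1/2) *\<^sub>R x + (1 - 1/2) *\<^sub>R y"
  have "?m \<in> C"
    using assms(2,4,5) unfolding convex_def by simp
  moreover have "h (t *\<^sub>R x + (1 - t) *\<^sub>R y) < ereal t * h x + ereal (1 - t) * h y"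
    if "t \<in> {0<..<1}" for t
    using assms(1,4,5) \<open>x \<noteq> y\<close> that unfolding strictly_convex_on_def by blast
  from this[of "1/2"] have "h ?m < ereal (1/2) * h x + ereal (1 - 1/2) * h y"
    by simp
  ultimately show False
    using assms(3-5) by simp
qed

theorem corollary5p2:
  fixes C :: "(real ^ 'd) set"
    and N :: "real ^ 'd \<Rightarrow> real"
    and h :: "real ^ 'd \<Rightarrow> ereal"
    and K M h_max h_min :: real
    and u :: "nat \<Rightarrow> ((real ^ 'd) \<Rightarrow>\<^sub>L real)"
    and x :: "nat \<Rightarrow> real ^ 'd"
  assumes "is_norm N"
    and "C \<noteq> {}" and "compact C" and "convex C"
    and "regularizer C h"
    and "K > 0" and "strongly_convex N K h"
    and "M > 0"
    and "\<forall>n\<ge>1. dual_norm N (u n) \<le> M"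
    and "h_max = real_of_ereal (max_over h C)"
    and "h_min = real_of_ereal (min_over h C)"
    and "x 1 = choice_map C h 0"
    and "\<forall>n\<ge>1. x (n + 1) =
           choice_map C h (sqrt (K * (h_max - h_min) / (M\<^sup>2 * real n)) *\<^sub>R (\<Sum>k=1..n. u k))"
  shows "\<forall>n\<ge>1.
           max_over (\<lambda>z. (\<Sum>k=1..n. blinfun_apply (u k) z)
                         - (\<Sum>k=1..n. blinfun_apply (u k) (x k))) C
             \<le> 2 * M * sqrt ((h_max - h_min) / K) * (1 / 4 + sqrt (real n))"
proof (intro allI impI)
  fix n :: nat
  assume n: "n \<ge> 1"
  define H where "H = h_max - h_min"
  define g where "g z = real_of_ereal (h z)" for z
  note fin = regularizer_finite[OF \<open>regularizer C h\<close>, folded g_def]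
  have cont: "continuous_on C h" and strict: "strictly_convex_on C h"
    using \<open>regularizer C h\<close> by (simp_all add: regularizer_def)
  have max: "g z \<le> h_max" and min: "h_min \<le> g z" if "z \<in> C" for z
  proof -
    obtain a b where ab: "a \<in> C" "max_over h C = h a" "b \<in> C" "min_over h C = h b"
      using max_over_attained(1)[OF \<open>compact C\<close> \<open>C \<noteq> {}\<close> cont]
        min_over_attained(1)[OF \<open>compact C\<close> \<open>C \<noteq> {}\<close> cont] by blast
    then have "h_max = g a" "h_min = g b"
      using assms(10,11) by (simp_all add: g_def)
    moreover have "h z \<le> h a" "h b \<le> h z"
      using max_over_attained(2)[OF \<open>compact C\<close> \<open>C \<noteq> {}\<close> cont that]
        min_over_attained(2)[OF \<open>compact C\<close> \<open>C \<noteq> {}\<close> cont that] ab by simp_all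
    ultimately show "g z \<le> h_max" "h_min \<le> g z"
      using fin[OF that] fin[OF ab(1)] fin[OF ab(3)] by (metis ereal_less_eq(3))+
  qed
  \<comment> \<open>Without \<open>max 1 k\<close>, division by zero would give rate 0 at
    \<open>k = 0\<close> and break positivity. The value there does not affect \<open>x 1\<close>,
    since the payoff sum is empty.\<close>
  define \<eta> where "\<eta> k = sqrt (K * H / (M\<^sup>2 * real (max 1 k)))" for k
  have x: "x (Suc k) = choice_map C h (\<eta> k *\<^sub>R (\<Sum>j=1..k. u j))" for k
    using assms(12,13) by (cases "k = 0") (auto simp: \<eta>_def H_def max_def)
  have xC: "x k \<in> C" if "k \<ge> 1" for k
    using x[of "k - 1"] that choice_map_maximizes(1)[OF \<open>C \<noteq> {}\<close> \<open>compact C\<close> \<open>convex C\<close> \<open>regularizer C h\<close>]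
    by simp
  let ?f = "\<lambda>z. (\<Sum>k=1..n. blinfun_apply (u k) z) - (\<Sum>k=1..n. blinfun_apply (u k) (x k))"
  have "continuous_on C ?f"
    by (intro continuous_intros)
  then obtain z where z: "z \<in> C" "max_over ?f C = ?f z"
    using max_over_attained(1)[OF \<open>compact C\<close> \<open>C \<noteq> {}\<close>] by blast
  have "H \<ge> 0"
    using max[OF z(1)] min[OF z(1)] by (simp add: H_def)
  have "?f z \<le> 2 * M * sqrt (H / K) * (1 / 4 + sqrt (real n))"
  proof (cases "H = 0")
    \<comment> \<open>All rates vanish, so the general regret bound does not apply. But
      \<open>h\<close> is constant on \<open>C\<close>, which is therefore a single point, and the
      regret is 0.\<close>
    case True
    then have "h w = ereal h_min" if "w \<in> C" for w
      using fin[OF that] max[OF that] min[OF that] by (simp add: H_def)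
    then have "x k = z" if "k \<ge> 1" for k
      using strictly_convex_on_constant[OF strict \<open>convex C\<close> _ xC[OF that] z(1)] by blast
    with True show ?thesis
      by simp
  next
    case False
    with \<open>H \<ge> 0\<close> have "H > 0"
      by simp
    define c where "c = sqrt (K * H) / M"
    have \<eta>_eq: "\<eta> k = c / sqrt (real (max 1 k))" for k
      using \<open>M > 0\<close> by (simp add: \<eta>_def c_def real_sqrt_divide real_sqrt_mult)
    have "c > 0"
      using \<open>H > 0\<close> \<open>K > 0\<close> \<open>M > 0\<close> by (simp add: c_def)
    have "\<eta> k > 0" for k
      unfolding \<eta>_eq using \<open>c > 0\<close> by simp
    moreover have "\<eta> (Suc k) \<le> \<eta> k" for k
      unfolding \<eta>_eq using \<open>c > 0\<close> by (intro divide_left_mono) auto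
    ultimately have regret: "?f z \<le> (g z - h_min) / \<eta> n + M\<^sup>2 / (2 * K) * (\<Sum>k<n. \<eta> k)"
      unfolding g_def
      using \<open>\<forall>n\<ge>1. dual_norm N (u n) \<le> M\<close> x z(1) min[unfolded g_def]
      by (intro regret_variable_rate[OF \<open>is_norm N\<close> \<open>C \<noteq> {}\<close> \<open>compact C\<close> \<open>convex C\<close>
            \<open>regularizer C h\<close> \<open>K > 0\<close> \<open>strongly_convex N K h\<close>]) auto
    have "(g z - h_min) / \<eta> n \<le> H / \<eta> n"
      using max[OF z(1)] \<open>\<eta> n > 0\<close> by (intro divide_right_mono) (auto simp: H_def)
    also have "H / \<eta> n = H / c * sqrt (real n)"
      using n by (simp add: \<eta>_eq max_def)
    finally have range: "(g z - h_min) / \<eta> n \<le> H / c * sqrt (real n)" .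
    have sum: "(\<Sum>k<n. \<eta> k) \<le> c * (1 + 2 * sqrt (real n))"
    proof -
      obtain m where m: "n = Suc m"
        using n by (cases n) auto
      \<comment> \<open>The rate at 0 equals \<open>c\<close> and is split off; it gives the summand
        1 in the bound, and in the end the \<open>1 / 4\<close>.\<close>
      have "(\<Sum>k<n. \<eta> k) = \<eta> 0 + (\<Sum>k=1..m. \<eta> k)"
        unfolding m lessThan_Suc_atMost atMost_atLeast0 by (simp add: sum.atLeast_Suc_atMost)
      also have "(\<Sum>k=1..m. \<eta> k) = c * (\<Sum>k=1..m. 1 / sqrt (real k))"
        unfolding sum_distrib_left by (intro sum.cong) (auto simp: \<eta>_eq max_def)
      also have "\<dots> \<le> c * (2 * sqrt (real m))"
        using \<open>c > 0\<close> sum_inverse_sqrt_le by (intro mult_left_mono) auto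
      also have "\<dots> \<le> c * (2 * sqrt (real n))"
        using \<open>c > 0\<close> m by (intro mult_left_mono) auto
      finally show ?thesis
        by (simp add: \<eta>_eq algebra_simps)
    qed
    note regret
    also have "(g z - h_min) / \<eta> n + M\<^sup>2 / (2 * K) * (\<Sum>k<n. \<eta> k)
        \<le> H / c * sqrt (real n) + M\<^sup>2 / (2 * K) * (c * (1 + 2 * sqrt (real n)))"
      using range sum \<open>K > 0\<close> by (intro add_mono mult_left_mono) auto
    \<comment> \<open>With this \<open>c\<close> both terms are multiples of
      \<open>M * sqrt (H / K)\<close>, with factors \<open>sqrt n\<close> and
      \<open>1 / 2 + sqrt n\<close>.\<close>
    also have "H / c * sqrt (real n) + M\<^sup>2 / (2 * K) * (c * (1 + 2 * sqrt (real n)))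
        = 2 * M * sqrt (H / K) * (1 / 4 + sqrt (real n))"
    proof -
      have Hc: "H / c = M * sqrt (H / K)"
        using \<open>H > 0\<close> \<open>K > 0\<close> \<open>M > 0\<close>
        by (simp add: c_def real_sqrt_divide real_sqrt_mult field_simps)
      have Mc: "M\<^sup>2 / (2 * K) * (c * t) = M * sqrt (H / K) / 2 * t" for t
      proof -
        have "M\<^sup>2 / (2 * K) * c = M * sqrt (H / K) / 2"
          using \<open>H > 0\<close> \<open>K > 0\<close> \<open>M > 0\<close>
          by (simp add: c_def real_sqrt_divide real_sqrt_mult field_simps power2_eq_square)
        then show ?thesis
          by (simp only: mult.assoc[symmetric])
      qed
      show ?thesis
        unfolding Hc Mc by (simp add: algebra_simps)
    qed
    finally show ?thesis .
  qed
  with z(2) show "max_over ?f C \<le> 2 * M * sqrt ((h_max - h_min) / K) * (1 / 4 + sqrt (real n))"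
    by (simp add: H_def)
qed

end
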